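(* Let $B_c>0$, $q_m\ge 0$, and $\Gamma_{1,m}\ge\Gamma_{2,m}>0$. Consider the optimization problem over $(p_{1,m},p_{2,m})\in\mathbb{R}^2$ $$\max\ \min\{R_{1,m}(p_{1,m},p_{2,m}),\,R_{2,m}(p_{1,m},p_{2,m})\}\quad\text{s.t.}\quad 0\le p_{1,m}\le p_{2,m},\ \ p_{1,m}+p_{2,m}=q_m,$$ where $$R_{1,m}=B_c\log(1+p_{1,m}\Gamma_{1,m}),\qquad R_{2,m}=B_c\log\left(1+\frac{p_{2,m}\Gamma_{2,m}}{p_{1,m}\Gamma_{2,m}+1}\right).$$ Then the optimal solution is $p_{1,m}^\star=\Lambda_m$ and $p_{2,m}^\star=q_m-p_{1,m}^\star$, where $$\Lambda_m=\frac{-(\Gamma_{1,m}+\Gamma_{2,m})+\sqrt{(\Gamma_{1,m}+\Gamma_{2,m})^2+4\Gamma_{1,m}\Gamma_{2,m}^2q_m}}{2\Gamma_{1,m}\Gamma_{2,m}}.$$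
   Context: Setting: downlink two-user NOMA on a single channel $m$ of bandwidth $B_c$. $\Gamma_{l,m}>0$ is the channel-to-noise ratio of user $l$ on channel $m$, $p_{l,m}$ its power, $R_{l,m}$ its rate, $q_m$ the power budget of the channel. $\log$ is the base-2 logarithm. *)

theory Defs
  imports Complex_Main
begin

text \<open>
  Downlink two-user NOMA on a single channel: \<open>B\<close> is the channel bandwidth, \<open>\<Gamma>1\<close> and \<open>\<Gamma>2\<close> are
  the channel-to-noise ratios of the two users, \<open>q\<close> is the power budget of the channel. The channel
  index \<open>m\<close> is fixed throughout and therefore dropped.
\<close>

definition rate1 :: "real \<Rightarrow> real \<Rightarrow> real \<times> real \<Rightarrow> real" where
  "rate1 B \<Gamma>1 = (\<lambda>(p1, p2). B * log 2 (1 + p1 * \<Gamma>1))"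

definition rate2 :: "real \<Rightarrow> real \<Rightarrow> real \<times> real \<Rightarrow> real" where
  "rate2 B \<Gamma>2 = (\<lambda>(p1, p2). B * log 2 (1 + p2 * \<Gamma>2 / (p1 * \<Gamma>2 + 1)))"

definition min_rate :: "real \<Rightarrow> real \<Rightarrow> real \<Rightarrow> real \<times> real \<Rightarrow> real" where
  "min_rate B \<Gamma>1 \<Gamma>2 p = min (rate1 B \<Gamma>1 p) (rate2 B \<Gamma>2 p)"

definition feasible :: "real \<Rightarrow> real \<times> real \<Rightarrow> bool" where
  "feasible q = (\<lambda>(p1, p2). 0 \<le> p1 \<and> p1 \<le> p2 \<and> p1 + p2 = q)"

definition \<Lambda> :: "real \<Rightarrow> real \<Rightarrow> real \<Rightarrow> real" where
  "\<Lambda> \<Gamma>1 \<Gamma>2 q =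
     (- (\<Gamma>1 + \<Gamma>2) + sqrt ((\<Gamma>1 + \<Gamma>2)\<^sup>2 + 4 * \<Gamma>1 * \<Gamma>2\<^sup>2 * q)) / (2 * \<Gamma>1 * \<Gamma>2)"

end

theory Submission
  imports Defs
begin

text \<open>
  Along the budget line the rate of user 1 strictly increases and that of user 2 strictly
  decreases in \<open>p1\<close>, so the minimum has a unique maximizer where the rates agree. Equating them
  gives \<open>\<Gamma>1 \<Gamma>2 p1\<^sup>2 + (\<Gamma>1 + \<Gamma>2) p1 = \<Gamma>2 q\<close>, whose nonnegative root is \<open>\<Lambda>\<close>; the condition
  \<open>\<Gamma>1 \<ge> \<Gamma>2\<close> makes this point satisfy \<open>p1 \<le> p2\<close>.
\<close>

lemma \<Lambda>_nonneg:
  assumes "q \<ge> 0" "\<Gamma>1 > 0" "\<Gamma>2 > 0"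
  shows "\<Lambda> \<Gamma>1 \<Gamma>2 q \<ge> 0"
proof -
  have "\<Gamma>1 + \<Gamma>2 \<le> sqrt ((\<Gamma>1 + \<Gamma>2)\<^sup>2 + 4 * \<Gamma>1 * \<Gamma>2\<^sup>2 * q)"
    using assms by (intro real_le_rsqrt) simp
  then show ?thesis
    using assms by (simp add: \<Lambda>_def)
qed

text \<open>This is the quadratic formula read backwards: isolating the square root in \<Lambda> and
  squaring gives the completed-square form of the equation.\<close>

lemma \<Lambda>_quadratic:
  assumes "q \<ge> 0" "\<Gamma>1 > 0" "\<Gamma>2 > 0"
  shows "\<Gamma>1 * \<Gamma>2 * (\<Lambda> \<Gamma>1 \<Gamma>2 q)\<^sup>2 + (\<Gamma>1 + \<Gamma>2) * \<Lambda> \<Gamma>1 \<Gamma>2 q = \<Gamma>2 * q"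
proof -
  define L where "L = \<Lambda> \<Gamma>1 \<Gamma>2 q"
  define d where "d = (\<Gamma>1 + \<Gamma>2)\<^sup>2 + 4 * \<Gamma>1 * \<Gamma>2\<^sup>2 * q"
  have "d \<ge> 0"
    using assms by (simp add: d_def)
  moreover have "2 * \<Gamma>1 * \<Gamma>2 * L + (\<Gamma>1 + \<Gamma>2) = sqrt d"
    using assms by (simp add: L_def \<Lambda>_def d_def)
  ultimately have "(2 * \<Gamma>1 * \<Gamma>2 * L + (\<Gamma>1 + \<Gamma>2))\<^sup>2 = d"
    by simp
  \<comment> \<open>Expanding the square, \<open>(\<Gamma>1 + \<Gamma>2)\<^sup>2\<close> cancels on
    both sides; what remains is the claim times four times the leading coefficient, a positive
    factor.\<close>
  then have "(4 * \<Gamma>1 * \<Gamma>2) * (\<Gamma>1 * \<Gamma>2 * L\<^sup>2 + (\<Gamma>1 + \<Gamma>2) * L) = (4 * \<Gamma>1 * \<Gamma>2) * (\<Gamma>2 * q)"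
    unfolding d_def by algebra
  then show ?thesis
    using assms by (simp add: L_def)
qed

lemma feasible_\<Lambda>:
  assumes "q \<ge> 0" "\<Gamma>1 \<ge> \<Gamma>2" "\<Gamma>2 > 0"
  shows "feasible q (\<Lambda> \<Gamma>1 \<Gamma>2 q, q - \<Lambda> \<Gamma>1 \<Gamma>2 q)"
proof -
  define L where "L = \<Lambda> \<Gamma>1 \<Gamma>2 q"
  have L0: "L \<ge> 0" and quad: "\<Gamma>1 * \<Gamma>2 * L\<^sup>2 + (\<Gamma>1 + \<Gamma>2) * L = \<Gamma>2 * q"
    using assms \<Lambda>_nonneg \<Lambda>_quadratic by (simp_all add: L_def)
  \<comment> \<open>The left side of the quadratic minus \<open>2 * \<Gamma>2 * L\<close>; the
    ordering of the channel gains keeps the linear coefficient nonnegative.\<close>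
  have "0 \<le> \<Gamma>1 * \<Gamma>2 * L\<^sup>2 + (\<Gamma>1 - \<Gamma>2) * L"
    using assms L0 by simp
  also have "\<dots> = \<Gamma>2 * (q - 2 * L)"
    using quad by algebra
  finally have "2 * L \<le> q"
    using assms by (simp add: zero_le_mult_iff)
  with L0 show ?thesis
    by (simp add: feasible_def L_def)
qed

text \<open>Clearing the positive denominator from the equality of the two signal-to-noise terms
  leaves exactly the quadratic satisfied by \<Lambda>.\<close>

lemma rate2_\<Lambda>:
  assumes "q \<ge> 0" "\<Gamma>1 > 0" "\<Gamma>2 > 0"
  defines "L \<equiv> \<Lambda> \<Gamma>1 \<Gamma>2 q"
  shows "rate2 B \<Gamma>2 (L, q - L) = rate1 B \<Gamma>1 (L, q - L)"
proof -
  have "L * \<Gamma>2 + 1 > 0"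
    using assms \<Lambda>_nonneg by (simp add: add_nonneg_pos)
  moreover have "(q - L) * \<Gamma>2 = L * \<Gamma>1 * (L * \<Gamma>2 + 1)"
    using \<Lambda>_quadratic[OF assms(1-3)] unfolding L_def by algebra
  ultimately have "(q - L) * \<Gamma>2 / (L * \<Gamma>2 + 1) = L * \<Gamma>1"
    by simp
  then show ?thesis
    by (simp add: rate1_def rate2_def)
qed

lemma rate1_strict_mono:
  assumes "B > 0" "\<Gamma>1 > 0" "0 \<le> p1" "p1 < r1"
  shows "rate1 B \<Gamma>1 (p1, p2) < rate1 B \<Gamma>1 (r1, r2)"
proof -
  have "0 < 1 + p1 * \<Gamma>1" "1 + p1 * \<Gamma>1 < 1 + r1 * \<Gamma>1"
    using assms by (simp_all add: add_pos_nonneg)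
  then have "log 2 (1 + p1 * \<Gamma>1) < log 2 (1 + r1 * \<Gamma>1)"
    by (intro log_less) simp_all
  with assms show ?thesis
    by (simp add: rate1_def)
qed

lemma rate2_strict_antimono:
  assumes "B > 0" "\<Gamma>2 > 0" "0 \<le> r1" "r1 < p1" "0 \<le> p2" "p2 < r2"
  shows "rate2 B \<Gamma>2 (p1, p2) < rate2 B \<Gamma>2 (r1, r2)"
proof -
  \<comment> \<open>Moving power from user 1 to user 2 raises the signal in the numerator and lowers
    the interference in the denominator.\<close>
  have "p2 * \<Gamma>2 / (p1 * \<Gamma>2 + 1) < r2 * \<Gamma>2 / (r1 * \<Gamma>2 + 1)"
    using assms by (intro frac_less) (auto simp: add_nonneg_pos)
  moreover have "0 \<le> p2 * \<Gamma>2 / (p1 * \<Gamma>2 + 1)"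
    using assms by simp
  ultimately show ?thesis
    using assms(1) by (simp add: rate2_def)
qed

lemma min_rate_less_\<Lambda>:
  assumes "B > 0" "q \<ge> 0" "\<Gamma>1 \<ge> \<Gamma>2" "\<Gamma>2 > 0" and p: "feasible q p"
  defines "L \<equiv> \<Lambda> \<Gamma>1 \<Gamma>2 q"
  assumes "p \<noteq> (L, q - L)"
  shows "min_rate B \<Gamma>1 \<Gamma>2 p < min_rate B \<Gamma>1 \<Gamma>2 (L, q - L)"
proof -
  obtain p1 where p_eq: "p = (p1, q - p1)" and p1: "0 \<le> p1" "p1 \<le> q - p1"
    using p by (cases p) (force simp: feasible_def)
  have "L \<ge> 0"
    using assms \<Lambda>_nonneg by simp
  moreover have "rate2 B \<Gamma>2 (L, q - L) = rate1 B \<Gamma>1 (L, q - L)"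
    using assms rate2_\<Lambda> by simp
  moreover have "p1 < L \<or> L < p1"
    using assms p_eq by auto
  \<comment> \<open>To the left of \<open>L\<close> user 1 falls below the common rate at
    \<open>L\<close>, to the right user 2 does; either one pulls the minimum down strictly.\<close>
  ultimately show ?thesis
    using assms p1 rate1_strict_mono[of B \<Gamma>1 p1 L "q - p1" "q - L"]
      rate2_strict_antimono[of B \<Gamma>2 L p1 "q - p1" "q - L"]
    by (auto simp: min_rate_def p_eq)
qed

theorem proposition1:
  fixes B \<Gamma>1 \<Gamma>2 q :: real
  assumes "B > 0" and "q \<ge> 0" and "\<Gamma>1 \<ge> \<Gamma>2" and "\<Gamma>2 > 0"
  shows "\<forall>p1 p2. is_arg_max (min_rate B \<Gamma>1 \<Gamma>2) (feasible q) (p1, p2) \<longleftrightarrow>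
           p1 = \<Lambda> \<Gamma>1 \<Gamma>2 q \<and> p2 = q - p1"
proof -
  define z where "z = (\<Lambda> \<Gamma>1 \<Gamma>2 q, q - \<Lambda> \<Gamma>1 \<Gamma>2 q)"
  have "feasible q z"
    using assms feasible_\<Lambda> by (simp add: z_def)
  moreover have "min_rate B \<Gamma>1 \<Gamma>2 p < min_rate B \<Gamma>1 \<Gamma>2 z" if "feasible q p" "p \<noteq> z" for p
    using assms min_rate_less_\<Lambda> that by (simp add: z_def)
  \<comment> \<open>\<open>z\<close> strictly beats every other feasible point, so nothing exceeds
    \<open>z\<close> and any other candidate is refuted by \<open>z\<close>.\<close>
  ultimately have "is_arg_max (min_rate B \<Gamma>1 \<Gamma>2) (feasible q) p \<longleftrightarrow> p = z" for p
    unfolding is_arg_max_def by (metis less_asym)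
  then show ?thesis
    by (auto simp: z_def)
qed

end
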